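(* Let $L>0$ and $\lambda_*>0$, and let $\beta^*\in\mathbb{R}^p$ be defined by $$\beta^*:=\arg\min\Big\{\|X(\beta-\beta^0)\|_n^2+\lambda_*^2|S_\beta|/\hat\phi^2(L,S_\beta):\ \|\beta\|_1\ge\|\beta^0\|_1\Big\}.$$ Let $S_*:=\{j:\beta_j^*\ne0\}$ be the active set of $\beta^*$. Then $$\lambda_*\|\beta^*-\beta^0\|_1\le\|X(\beta^*-\beta^0)\|_n^2+\frac{\lambda_*^2|S_*|}{\hat\phi^2(1,S_* )}.$$
   Context: $X$ is a fixed $n\times p$ real matrix of rank $n$ and $\beta^0\in\mathbb{R}^p$ is a fixed vector. For $v\in\mathbb{R}^n$, $\|v\|_n:=\sqrt{v^Tv/n}$. For $\beta\in\mathbb{R}^p$, $S_\beta:=\{j:\beta_j\ne0\}$. For $S\subset\{1,\dots,p\}$, $\beta_S\in\mathbb{R}^p$ has entries $\beta_j$ for $j\in S$ and $0$ otherwise. The compatibility constant, for $L>0$, is $$\hat\phi^2(L,S):=\min\{|S|\,\|X\beta_S-X\beta_{S^c}\|_n^2:\ \|\beta_S\|_1=1,\ \|\beta_{S^c}\|_1\le L\}.$$ Conventions: $|S|/\hat\phi^2(L,S)$ is $0$ if $S=\emptyset$ and $+\infty$ if $S\ne\emptyset$ and $\hat\phi(L,S)=0$. $\beta^*$ is any minimizer (assumed to exist). *)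

theory Defs
  imports "HOL-Analysis.Analysis"
begin

definition norm_n :: "real ^ 'n \<Rightarrow> real" where
  "norm_n v = sqrt ((v \<bullet> v) / real CARD('n))"

definition l1_norm :: "real ^ 'p \<Rightarrow> real" where
  "l1_norm b = (\<Sum>j\<in>UNIV. \<bar>b $ j\<bar>)"

definition active_set :: "real ^ 'p \<Rightarrow> 'p set" where
  "active_set b = {j. b $ j \<noteq> 0}"

definition restrict_vec :: "real ^ 'p \<Rightarrow> 'p set \<Rightarrow> real ^ 'p" where
  "restrict_vec b S = (\<chi> j. if j \<in> S then b $ j else 0)"

definition compat_values :: "real ^ 'p ^ 'n \<Rightarrow> real \<Rightarrow> 'p set \<Rightarrow> real set" where
  "compat_values X L S =
     {real (card S) * (norm_n (X *v restrict_vec b S - X *v restrict_vec b (- S)))\<^sup>2 | b.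
        l1_norm (restrict_vec b S) = 1 \<and> l1_norm (restrict_vec b (- S)) \<le> L}"

text \<open>
  The squared compatibility constant. For nonempty \<open>S\<close> and \<open>L > 0\<close> the infimum is a minimum,
  see \<open>compat_sq_is_min\<close> below. For empty \<open>S\<close> the set of values is empty and the
  number is meaningless; it is only ever used through \<open>compat_ratio\<close>.
\<close>

definition compat_sq :: "real ^ 'p ^ 'n \<Rightarrow> real \<Rightarrow> 'p set \<Rightarrow> real" where
  "compat_sq X L S = Inf (compat_values X L S)"

text \<open>The extended real number \<open>|S| / compat_sq X L S\<close>.\<close>

definition compat_ratio :: "real ^ 'p ^ 'n \<Rightarrow> real \<Rightarrow> 'p set \<Rightarrow> ereal" where
  "compat_ratio X L S =
     (if S = {} then 0
      else if compat_sq X L S = 0 then \<infinity>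
      else ereal (real (card S) / compat_sq X L S))"

lemma compat_sq_is_min:
  fixes X :: "real ^ 'p ^ 'n"
  assumes "S \<noteq> {}" and "L > 0"
  shows "compat_sq X L S \<in> compat_values X L S"
    and "\<And>v. v \<in> compat_values X L S \<Longrightarrow> compat_sq X L S \<le> v"
proof -
  define K where "K = {b. l1_norm (restrict_vec b S) = 1 \<and> l1_norm (restrict_vec b (- S)) \<le> L}"
  define f where "f b = real (card S) *
      (norm_n (X *v restrict_vec b S - X *v restrict_vec b (- S)))\<^sup>2" for b
  have vals: "compat_values X L S = f ` K"
    unfolding compat_values_def K_def f_def by auto
  have cr: "continuous_on A (\<lambda>b. restrict_vec b T)" for T :: "'p set" and A
    unfolding restrict_vec_def
  proof (intro continuous_on_vec_lambda)
    fix j show "continuous_on A (\<lambda>b. if j \<in> T then b $ j else 0)"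
      by (cases "j \<in> T") (auto intro!: continuous_intros)
  qed
  have cl: "continuous_on A (\<lambda>b. l1_norm (restrict_vec b T))" for T :: "'p set" and A
    unfolding l1_norm_def by (intro continuous_intros cr)
  have "closed K"
    unfolding K_def by (intro closed_Collect_conj closed_Collect_eq closed_Collect_le cl continuous_intros)
  moreover have "bounded K"
  proof (rule boundedI)
    fix b assume b: "b \<in> K"
    have "norm b \<le> (\<Sum>j\<in>UNIV. \<bar>b $ j\<bar>)" by (rule norm_le_l1_cart)
    also have "\<dots> = l1_norm (restrict_vec b S) + l1_norm (restrict_vec b (- S))"
      unfolding l1_norm_def restrict_vec_def sum.distrib[symmetric] by (intro sum.cong) auto
    also have "\<dots> \<le> 1 + L" using b by (auto simp: K_def)
    finally show "norm b \<le> 1 + L" .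
  qed
  ultimately have "compact K" by (simp add: compact_eq_bounded_closed)
  moreover have "K \<noteq> {}"
  proof -
    obtain i where i: "i \<in> S" using assms by auto
    have "restrict_vec (axis i 1) S = axis i 1" "restrict_vec (axis i 1) (- S) = 0"
      using i by (auto simp: restrict_vec_def vec_eq_iff axis_def)
    then have "axis i 1 \<in> K"
      using assms by (simp add: K_def l1_norm_def axis_def if_distrib[of abs] cong: if_cong)
    then show ?thesis by auto
  qed
  moreover have "continuous_on K f"
    unfolding f_def norm_n_def
    by (intro continuous_intros cr
        bounded_linear.continuous_on[OF matrix_vector_mul_bounded_linear]) auto
  ultimately obtain b where b: "b \<in> K" "\<forall>c\<in>K. f b \<le> f c"
    using continuous_attains_inf by blast
  then have "compat_sq X L S = f b"
    unfolding compat_sq_def vals by (intro cInf_eq_minimum) auto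
  then show "compat_sq X L S \<in> compat_values X L S"
    and "\<And>v. v \<in> compat_values X L S \<Longrightarrow> compat_sq X L S \<le> v"
    using b vals by auto
qed

end

theory Submission
  imports Defs
begin

text \<open>
  Put \<open>\<delta> = \<beta>\<^sup>* - \<beta>\<^sup>0\<close>. Since \<open>\<beta>\<^sup>*\<close> vanishes off its active set \<open>S\<close>, the constraint
  \<open>\<parallel>\<beta>\<^sup>0\<parallel>\<^sub>1 \<le> \<parallel>\<beta>\<^sup>*\<parallel>\<^sub>1\<close> places \<open>\<delta>\<close> in the cone where the part of \<open>\<delta>\<close> off \<open>S\<close> has \<open>\<ell>\<^sub>1\<close>-norm at most
  that of the part on \<open>S\<close>. Then \<open>\<parallel>\<delta>\<parallel>\<^sub>1\<close> is at most twice the \<open>\<ell>\<^sub>1\<close>-norm of the part on \<open>S\<close>, which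
  compatibility with constant 1 bounds by a multiple of \<open>\<parallel>X \<delta>\<parallel>\<^sub>n\<close>, and \<open>2 a b \<le> a\<^sup>2 + b\<^sup>2\<close> concludes.
\<close>

lemma l1_norm_nonneg: "l1_norm b \<ge> 0"
  by (simp add: l1_norm_def sum_nonneg)

lemma l1_norm_split:
  "l1_norm b = l1_norm (restrict_vec b S) + l1_norm (restrict_vec b (- S))"
  unfolding l1_norm_def restrict_vec_def sum.distrib[symmetric] by (intro sum.cong) auto

lemma l1_norm_scaleR: "l1_norm (c *\<^sub>R b) = \<bar>c\<bar> * l1_norm b"
  by (simp add: l1_norm_def abs_mult sum_distrib_left)

lemma l1_norm_minus: "l1_norm (- b) = l1_norm b"
  by (simp add: l1_norm_def)

lemma l1_norm_triangle: "l1_norm (a + b) \<le> l1_norm a + l1_norm b"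
  unfolding l1_norm_def sum.distrib[symmetric] by (intro sum_mono) simp

lemma norm_n_scaleR: "norm_n (c *\<^sub>R v) = \<bar>c\<bar> * norm_n v"
  by (simp add: norm_n_def real_sqrt_mult real_sqrt_divide)

text \<open>The minimum is attained, so the constant is itself one of the values, each a nonnegative
  multiple of a square.\<close>

lemma compat_sq_nonneg:
  assumes "S \<noteq> {}" "L > 0"
  shows "compat_sq X L S \<ge> 0"
  using compat_sq_is_min(1)[OF assms, of X] by (auto simp: compat_values_def)

text \<open>Both sides are homogeneous of degree 2 in \<open>d\<close>. Scaling the part on
  \<open>S\<close> to unit norm turns the cone condition into feasibility for the minimum.\<close>

lemma compat_sq_cone:
  fixes X :: "real ^ 'p ^ 'n"
  assumes "S \<noteq> {}" "L > 0"
    and cone: "l1_norm (restrict_vec d (- S)) \<le> L * l1_norm (restrict_vec d S)"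
  shows "compat_sq X L S * (l1_norm (restrict_vec d S))\<^sup>2
           \<le> real (card S) * (norm_n (X *v d))\<^sup>2"
proof (cases "l1_norm (restrict_vec d S) = 0")
  case True
  then show ?thesis by simp
next
  case False
  define m where "m = l1_norm (restrict_vec d S)"
  have m: "m > 0"
    using False l1_norm_nonneg[of "restrict_vec d S"] by (simp add: m_def)
  \<comment> \<open>The sign flip off \<open>S\<close> matches the minus sign in the definition of the constant.\<close>
  define b where "b = (1 / m) *\<^sub>R (restrict_vec d S - restrict_vec d (- S))"
  have bS: "restrict_vec b S = (1 / m) *\<^sub>R restrict_vec d S"
    and bC: "restrict_vec b (- S) = - ((1 / m) *\<^sub>R restrict_vec d (- S))"
    and d: "restrict_vec d S + restrict_vec d (- S) = d"
    by (auto simp: b_def restrict_vec_def vec_eq_iff)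
  have "l1_norm (restrict_vec b S) = 1"
    using m by (simp add: bS l1_norm_scaleR m_def)
  moreover have "l1_norm (restrict_vec b (- S)) \<le> L"
    using m cone by (simp add: bC l1_norm_minus l1_norm_scaleR m_def divide_le_eq)
  ultimately have "compat_sq X L S
      \<le> real (card S) * (norm_n (X *v restrict_vec b S - X *v restrict_vec b (- S)))\<^sup>2"
    by (intro compat_sq_is_min(2)[OF assms(1,2)]) (auto simp: compat_values_def)
  also have "X *v restrict_vec b S - X *v restrict_vec b (- S) = X *v ((1 / m) *\<^sub>R d)"
    by (simp only: matrix_vector_mult_diff_distrib[symmetric] bS bC diff_minus_eq_add
        scaleR_add_right[symmetric] d)
  also have "\<dots> = (1 / m) *\<^sub>R (X *v d)"
    by (simp add: matrix_vector_mult_scaleR)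
  finally show ?thesis
    unfolding m_def[symmetric] using m
    by (simp add: norm_n_scaleR power_divide pos_le_divide_eq)
qed

text \<open>Off the active set of \<open>b\<close> the difference is \<open>- c\<close>. On it, the
  triangle inequality bounds the norm of \<open>b\<close>, and the contribution of \<open>c\<close>
  there cancels.\<close>

lemma l1_norm_diff_cone:
  assumes "l1_norm c \<le> l1_norm b"
  shows "l1_norm (restrict_vec (b - c) (- active_set b))
           \<le> l1_norm (restrict_vec (b - c) (active_set b))"
proof -
  let ?S = "active_set b"
  have off: "restrict_vec (b - c) (- ?S) = - restrict_vec c (- ?S)"
    by (auto simp: restrict_vec_def active_set_def vec_eq_iff)
  have "b = restrict_vec (b - c) ?S + restrict_vec c ?S"
    by (auto simp: restrict_vec_def active_set_def vec_eq_iff)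
  then have "l1_norm b \<le> l1_norm (restrict_vec (b - c) ?S) + l1_norm (restrict_vec c ?S)"
    using l1_norm_triangle by metis
  then show ?thesis
    using assms l1_norm_split[of c ?S] by (simp add: off l1_norm_minus)
qed

theorem lemma1p3p1:
  fixes X :: "real ^ 'p ^ 'n"
    and \<beta>0 \<beta>star :: "real ^ 'p"
    and L lam :: real
  assumes "rank X = CARD('n)"
    and "L > 0"
    and "lam > 0"
    and "is_arg_min
           (\<lambda>\<beta>. ereal ((norm_n (X *v (\<beta> - \<beta>0)))\<^sup>2)
                 + ereal (lam\<^sup>2) * compat_ratio X L (active_set \<beta>))
           (\<lambda>\<beta>. l1_norm \<beta> \<ge> l1_norm \<beta>0)
           \<beta>star"
  shows "ereal (lam * l1_norm (\<beta>star - \<beta>0))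
           \<le> ereal ((norm_n (X *v (\<beta>star - \<beta>0)))\<^sup>2)
              + ereal (lam\<^sup>2) * compat_ratio X 1 (active_set \<beta>star)"
proof -
  define S where "S = active_set \<beta>star"
  define d where "d = \<beta>star - \<beta>0"
  define m where "m = l1_norm (restrict_vec d S)"
  define q where "q = norm_n (X *v d)"
  define \<phi> where "\<phi> = compat_sq X 1 S"
  have cone: "l1_norm (restrict_vec d (- S)) \<le> m"
    using assms(4) l1_norm_diff_cone by (auto simp: is_arg_min_def S_def d_def m_def)
  then have l1: "l1_norm d \<le> 2 * m"
    using l1_norm_split[of d S] by (simp add: m_def)
  have "ereal (lam * l1_norm d) \<le> ereal (q\<^sup>2) + ereal (lam\<^sup>2) * compat_ratio X 1 S"
  proof (cases "S = {}")
    \<comment> \<open>Here the ratio is 0, and the cone condition forces \<open>d\<close> to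
      vanish.\<close>
    case True
    then have "m = 0"
      by (simp add: m_def restrict_vec_def l1_norm_def)
    then have "lam * l1_norm d \<le> 0"
      using l1 \<open>lam > 0\<close> by (simp add: mult_nonneg_nonpos)
    also have "0 \<le> q\<^sup>2"
      by simp
    finally show ?thesis
      using True by (simp add: compat_ratio_def)
  next
    case S: False
    show ?thesis
    proof (cases "\<phi> = 0")
      \<comment> \<open>The ratio is infinite and \<open>lam\<close> is positive, so the right-hand
        side is infinite.\<close>
      case True
      then show ?thesis
        using S \<open>lam > 0\<close> by (simp add: compat_ratio_def \<phi>_def)
    next
      case False
      then have \<phi>: "\<phi> > 0"
        using compat_sq_nonneg[OF S, of 1 X] by (simp add: \<phi>_def)
      define r where "r = real (card S) / \<phi>"
      have r: "r \<ge> 0"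
        using \<phi> by (simp add: r_def)
      have "\<phi> * m\<^sup>2 \<le> real (card S) * q\<^sup>2"
        using compat_sq_cone[OF S, of 1 d X] cone by (simp add: \<phi>_def m_def q_def)
      then have "m\<^sup>2 \<le> r * q\<^sup>2"
        using \<phi> by (simp add: r_def field_simps)
      moreover have "0 \<le> q"
        by (simp add: q_def norm_n_def)
      ultimately have "m \<le> sqrt r * q"
        using r by (intro power2_le_imp_le[of m]) (simp_all add: power_mult_distrib)
      then have "lam * l1_norm d \<le> lam * (2 * (sqrt r * q))"
        using l1 \<open>lam > 0\<close> by (intro mult_left_mono) auto
      \<comment> \<open>Regrouped so that the factor 2 from the cone bound becomes the 2 of the
        cross term of \<open>q\<close> and \<open>lam * sqrt r\<close>.\<close>
      also have "\<dots> = 2 * q * (lam * sqrt r)"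
        by simp
      also have "\<dots> \<le> q\<^sup>2 + (lam * sqrt r)\<^sup>2"
        by (rule sum_squares_bound)
      also have "\<dots> = q\<^sup>2 + lam\<^sup>2 * r"
        using r by (simp add: power_mult_distrib)
      finally show ?thesis
        using S False by (simp add: compat_ratio_def \<phi>_def r_def)
    qed
  qed
  then show ?thesis
    by (simp add: S_def d_def q_def)
qed

end
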